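(* Suppose $X$ is a complete metric space, $A$ and $B$ are closed subsets of $X$, $a\in A$, $b\in B$, and $\varepsilon>0$. If $$d(a,b)<d(A,B)+\varepsilon,$$ then, for any $\lambda>0$, there exist $\hat a\in A\cap B_\lambda(a)$ and $\hat b\in B\cap B_\lambda(b)$ such that (i) $d(\hat a,\hat b)\le d(a,b)$; (ii) $d\big(A\cap B_{\xi}(\hat a),\,B\cap B_{\xi}(\hat b)\big)+\dfrac{\xi\varepsilon}{\lambda}>d(\hat a,\hat b)$ for all $\xi>0$.
   Context: $d(\cdot,\cdot)$ is the metric of $X$; $B_\delta(x)$ (with subscript) denotes the open ball with centre $x$ and radius $\delta>0$ (not to be confused with the set $B$). For nonempty subsets $A,B\subset X$, $d(A,B):=\inf_{a\in A,\,b\in B}d(a,b)$. *)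

theory Defs
  imports "HOL-Analysis.Analysis"
begin

end

(* Ekeland's variational principle, applied to the function (u, v) |-> d(u, v) on A x B with a
   multiple of the max-metric, moves (a, b) to a point that no pair (u, v) improves on at a rate
   better than that multiple. Since d(a, b) - d(A, B) is strictly below epsilon, the slope can be
   taken strictly below epsilon / lambda, which makes all the resulting inequalities strict. *)
theory Submission
  imports Defs
begin

text \<open>Only the triangle inequality for \<open>\<rho>\<close> and the bound \<open>dist \<le> C * \<rho>\<close> are required, so that
  the max-metric can be used on a product, whose \<open>dist\<close> is the Euclidean one; lower
  semicontinuity enters as closedness of the sets in \<open>closed_below\<close>.\<close>

lemma ekeland_variational_principle:
  fixes f :: "'a::complete_space \<Rightarrow> real" and \<rho> :: "'a \<Rightarrow> 'a \<Rightarrow> real"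
  assumes refl: "\<And>x. \<rho> x x = 0"
    and triangle: "\<And>x y z. \<rho> x z \<le> \<rho> x y + \<rho> y z"
    and dist_le: "\<And>x y. dist x y \<le> C * \<rho> x y" and "C > 0"
    and closed_below: "\<And>x. x \<in> S \<Longrightarrow> closed {y \<in> S. f y + \<rho> x y \<le> f x}"
    and bdd: "bdd_below (f ` S)"
    and "x0 \<in> S"
  obtains z where "z \<in> S" "f z + \<rho> x0 z \<le> f x0"
    and "\<And>w. w \<in> S \<Longrightarrow> w \<noteq> z \<Longrightarrow> f z < f w + \<rho> z w"
proof -
  \<comment> \<open>\<open>P x\<close> collects the points at or below \<open>x\<close> in the
    Ekeland preorder; transitivity comes from the triangle inequality for
    \<open>\<rho>\<close>.\<close>
  define P where "P x = {y \<in> S. f y + \<rho> x y \<le> f x}" for x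
  have \<rho>_nonneg: "0 \<le> \<rho> x y" for x y
    using dist_le[of x y] \<open>C > 0\<close> zero_le_dist[of x y] by (smt (verit) mult_pos_neg)
  have P_refl: "x \<in> P x" if "x \<in> S" for x
    using that by (simp add: P_def refl)
  have P_trans: "z \<in> P x" if "y \<in> P x" "z \<in> P y" for x y z
    using that triangle[of x z y] by (auto simp: P_def)
  have bddP: "bdd_below (f ` P x)" for x
    by (rule bdd_below_mono[OF bdd]) (auto simp: P_def)
  \<comment> \<open>A successor goes at least halfway from \<open>f x\<close> down to the infimum of
    \<open>f\<close> on \<open>P x\<close>. If \<open>f x\<close> already is that infimum,
    \<open>x\<close> is its own successor.\<close>
  have step: "\<exists>y. y \<in> P x \<and> (\<forall>w \<in> P x. f y \<le> (f x + f w) / 2)" if x: "x \<in> S" for x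
  proof (cases "Inf (f ` P x) < f x")
    case True
    have "Inf (f ` P x) < (f x + Inf (f ` P x)) / 2" using True by simp
    then obtain y where y: "y \<in> P x" "f y < (f x + Inf (f ` P x)) / 2"
      using cInf_less_iff[OF _ bddP[of x]] P_refl[OF x] by blast
    have "f y \<le> (f x + f w) / 2" if "w \<in> P x" for w
      using y(2) cINF_lower[OF bddP that] by simp
    with y(1) show ?thesis by blast
  next
    case False
    have "f x \<le> (f x + f w) / 2" if "w \<in> P x" for w
      using False cINF_lower[OF bddP that] by simp
    with P_refl[OF x] show ?thesis by blast
  qed
  have "\<exists>s. s 0 = x0 \<and> (\<forall>n. s n \<in> S \<and> s (Suc n) \<in> P (s n) \<and>
          (\<forall>w \<in> P (s n). f (s (Suc n)) \<le> (f (s n) + f w) / 2))"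
  proof -
    from step obtain g where g: "\<And>x. x \<in> S \<Longrightarrow> g x \<in> P x"
      "\<And>x w. x \<in> S \<Longrightarrow> w \<in> P x \<Longrightarrow> f (g x) \<le> (f x + f w) / 2"
      by metis
    have S: "(g ^^ n) x0 \<in> S" for n
      by (induction n) (use \<open>x0 \<in> S\<close> g(1) in \<open>auto simp: P_def\<close>)
    show ?thesis
      by (rule exI[of _ "\<lambda>n. (g ^^ n) x0"]) (use S g in auto)
  qed
  then obtain s where s0: "s 0 = x0" and sS: "\<And>n. s n \<in> S"
    and sP: "\<And>n. s (Suc n) \<in> P (s n)"
    and half: "\<And>n w. w \<in> P (s n) \<Longrightarrow> f (s (Suc n)) \<le> (f (s n) + f w) / 2"
    by blast
  have mono: "s m \<in> P (s n)" if "n \<le> m" for m n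
    using that by (induction rule: dec_induct) (use sS P_refl sP P_trans in blast)+
  have "decseq (\<lambda>n. f (s n))"
    unfolding decseq_Suc_iff
  proof
    fix n show "f (s (Suc n)) \<le> f (s n)"
      using sP[of n] \<rho>_nonneg[of "s n" "s (Suc n)"] by (simp add: P_def)
  qed
  moreover obtain c where "\<And>x. x \<in> S \<Longrightarrow> c \<le> f x"
    using bdd by (auto simp: bdd_below_def)
  ultimately obtain L where L: "(\<lambda>n. f (s n)) \<longlonglongrightarrow> L" and L_le: "\<And>n. L \<le> f (s n)"
    using decseq_convergent[of "\<lambda>n. f (s n)" c] sS by metis
  \<comment> \<open>Along the descending sequence \<open>\<rho>\<close> is bounded by the drop in
    \<open>f\<close>, which tends to 0 because the values converge.\<close>
  have "Cauchy s"
  proof (rule CauchyI')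
    fix e :: real assume "e > 0"
    then have "\<forall>\<^sub>F n in sequentially. f (s n) < L + e / C"
      using order_tendstoD(2)[OF L] \<open>C > 0\<close> by simp
    then obtain M where M: "\<And>n. n \<ge> M \<Longrightarrow> f (s n) < L + e / C"
      by (auto simp: eventually_sequentially)
    show "\<exists>M. \<forall>m\<ge>M. \<forall>n>m. dist (s m) (s n) < e"
    proof (intro exI[of _ M] allI impI)
      fix m n assume "M \<le> m" "m < n"
      have "\<rho> (s m) (s n) \<le> f (s m) - f (s n)"
        using mono[of m n] \<open>m < n\<close> by (simp add: P_def)
      also have "\<dots> < e / C"
        using M[OF \<open>M \<le> m\<close>] L_le[of n] by simp
      finally show "dist (s m) (s n) < e"
        using dist_le[of "s m" "s n"] \<open>C > 0\<close> by (simp add: field_simps)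
    qed
  qed
  then obtain z where z: "s \<longlonglongrightarrow> z"
    using Cauchy_convergent_iff convergent_def by blast
  have zP: "z \<in> P (s n)" for n
  proof (rule Lim_in_closed_set[OF _ _ _ z])
    show "closed (P (s n))"
      unfolding P_def by (rule closed_below[OF sS])
    show "\<forall>\<^sub>F m in sequentially. s m \<in> P (s n)"
      using mono eventually_sequentially by blast
  qed simp
  have "f z \<le> f (s n)" for n
    using zP[of n] \<rho>_nonneg[of "s n" z] by (simp add: P_def)
  then have fz: "f z \<le> L"
    using LIMSEQ_le_const[OF L] by blast
  \<comment> \<open>A counterexample \<open>w\<close> would lie below every \<open>s n\<close>, so
    it competes in every halving. In the limit this gives \<open>L \<le> f w\<close>, hence
    \<open>f z \<le> f w\<close>, which leaves no room for a positive
    \<open>\<rho> z w\<close>.\<close>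
  have "f z < f w + \<rho> z w" if w: "w \<in> S" "w \<noteq> z" for w
  proof (rule ccontr)
    assume "\<not> f z < f w + \<rho> z w"
    then have "w \<in> P z" using w by (simp add: P_def)
    then have "w \<in> P (s n)" for n using zP P_trans by blast
    from half[OF this] have "f (s (Suc n)) \<le> (f (s n) + f w) / 2" for n .
    moreover have "(\<lambda>n. f (s (Suc n))) \<longlonglongrightarrow> L"
      using L by (rule LIMSEQ_Suc)
    moreover have "(\<lambda>n. (f (s n) + f w) / 2) \<longlonglongrightarrow> (L + f w) / 2"
      by (intro tendsto_intros L) simp
    ultimately have "L \<le> (L + f w) / 2"
      by (intro LIMSEQ_le) auto
    with fz have "f z \<le> f w" by simp
    with \<open>w \<in> P z\<close> have "\<rho> z w \<le> 0" by (simp add: P_def)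
    then have "C * \<rho> z w \<le> 0" using \<open>C > 0\<close> by (simp add: mult_le_0_iff)
    with dist_le[of z w] have "dist z w \<le> 0" by linarith
    with w show False by simp
  qed
  moreover have "z \<in> S" "f z + \<rho> x0 z \<le> f x0"
    using zP[of 0] by (auto simp: P_def s0)
  ultimately show thesis using that by blast
qed

theorem mainTheorem3:
  fixes A B :: "'a::complete_space set"
    and a b :: 'a
    and \<epsilon> :: real
  assumes "closed A" and "closed B"
    and "a \<in> A" and "b \<in> B"
    and "\<epsilon> > 0"
    and "dist a b < setdist A B + \<epsilon>"
  shows "\<forall>lam::real. lam > 0 \<longrightarrow>
    (\<exists>a' \<in> A \<inter> ball a lam. \<exists>b' \<in> B \<inter> ball b lam.
      dist a' b' \<le> dist a b \<and>
      (\<forall>\<xi>::real. \<xi> > 0 \<longrightarrow>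
        setdist (A \<inter> ball a' \<xi>) (B \<inter> ball b' \<xi>) + \<xi> * \<epsilon> / lam > dist a' b'))"
proof (intro allI impI)
  fix lam :: real assume "lam > 0"
  \<comment> \<open>The lower bound on \<open>\<delta>\<close> keeps the new points strictly inside
    the balls of radius \<open>lam\<close>; the upper bound makes (ii) strict.\<close>
  obtain \<delta> where \<delta>: "\<delta> < \<epsilon>" "max 0 (dist a b - setdist A B) < \<delta>"
    using dense[of "max 0 (dist a b - setdist A B)" \<epsilon>] assms(5,6) by auto
  define \<alpha> where "\<alpha> = \<delta> / lam"
  have "\<alpha> > 0" using \<delta> \<open>lam > 0\<close> by (simp add: \<alpha>_def)
  define f where "f p = dist (fst p) (snd p)" for p :: "'a \<times> 'a"
  define r where "r p q = max (dist (fst p) (fst q)) (dist (snd p) (snd q))" for p q :: "'a \<times> 'a"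
  obtain z where z: "z \<in> A \<times> B" "f z + \<alpha> * r (a, b) z \<le> f (a, b)"
    and min: "\<And>w. w \<in> A \<times> B \<Longrightarrow> w \<noteq> z \<Longrightarrow> f z < f w + \<alpha> * r z w"
  \<comment> \<open>The factor \<open>2 / \<alpha>\<close> arises because the Euclidean product
    distance is at most the sum of the coordinate distances, hence at most twice their
    maximum.\<close>
  proof (rule ekeland_variational_principle[of "\<lambda>p q. \<alpha> * r p q" "2 / \<alpha>" "A \<times> B" f "(a, b)"])
    show "\<alpha> * r x x = 0" for x by (simp add: r_def)
    show "\<alpha> * r x w \<le> \<alpha> * r x y + \<alpha> * r y w" for x y w
    proof -
      have "r x w \<le> r x y + r y w"
        unfolding r_def
        using dist_triangle[of "fst x" "fst w" "fst y"] dist_triangle[of "snd x" "snd w" "snd y"]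
        by linarith
      then show ?thesis
        using \<open>\<alpha> > 0\<close> by (simp flip: distrib_left)
    qed
    show "dist x y \<le> 2 / \<alpha> * (\<alpha> * r x y)" for x y
    proof -
      have "dist x y \<le> dist (fst x) (fst y) + dist (snd x) (snd y)"
        by (simp add: dist_prod_def sqrt_sum_squares_le_sum)
      also have "\<dots> \<le> 2 * r x y" by (simp add: r_def)
      finally show ?thesis using \<open>\<alpha> > 0\<close> by simp
    qed
    show "2 / \<alpha> > 0" using \<open>\<alpha> > 0\<close> by simp
    show "closed {y \<in> A \<times> B. f y + \<alpha> * r x y \<le> f x}" for x
    proof -
      have "closed ((A \<times> B) \<inter> {y. f y + \<alpha> * r x y \<le> f x})"
        unfolding f_def r_def
        by (intro closed_Int closed_Times assms closed_Collect_le continuous_intros)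
      then show ?thesis by (simp add: Int_def)
    qed
    show "bdd_below (f ` (A \<times> B))"
      by (rule bdd_belowI[of _ 0]) (auto simp: f_def)
  qed (use assms in auto)
  obtain a' b' where [simp]: "z = (a', b')" by fastforce
  have ab': "a' \<in> A" "b' \<in> B" using z(1) by auto
  have le: "dist a' b' + \<alpha> * r (a, b) z \<le> dist a b"
    using z(2) by (simp add: f_def)
  \<comment> \<open>The total drop from \<open>dist a b\<close> cannot exceed
    \<open>dist a b - setdist A B\<close>, which is less than
    \<open>\<delta> = \<alpha> * lam\<close>.\<close>
  have "\<alpha> * r (a, b) z < \<alpha> * lam"
    using le setdist_le_dist[OF ab'] \<delta>(2) \<open>lam > 0\<close> by (simp add: \<alpha>_def)
  then have "r (a, b) z < lam" using \<open>\<alpha> > 0\<close> by simp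
  then have ball: "a' \<in> ball a lam" "b' \<in> ball b lam"
    by (auto simp: r_def)
  have "0 \<le> r (a, b) z" by (simp add: r_def le_max_iff_disj)
  with le \<open>\<alpha> > 0\<close> have i: "dist a' b' \<le> dist a b"
    by (smt (verit) mult_nonneg_nonneg)
  have ii: "setdist (A \<inter> ball a' \<xi>) (B \<inter> ball b' \<xi>) + \<xi> * \<epsilon> / lam > dist a' b'" if "\<xi> > 0" for \<xi>
  proof -
    \<comment> \<open>Since \<open>r\<close> is the max-metric, pairs from the two
      \<open>\<xi>\<close>-balls are within \<open>\<xi>\<close> of \<open>z\<close>. The pair
      \<open>z\<close> itself is treated apart, as \<open>min\<close> speaks only of other
      points.\<close>
    have "dist a' b' - \<alpha> * \<xi> \<le> dist u v"
      if uv: "u \<in> A \<inter> ball a' \<xi>" "v \<in> B \<inter> ball b' \<xi>" for u v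
    proof (cases "(u, v) = z")
      case True
      then show ?thesis using \<open>\<alpha> > 0\<close> \<open>\<xi> > 0\<close> by simp
    next
      case False
      have "dist a' b' < dist u v + \<alpha> * r z (u, v)"
        using min[of "(u, v)"] False uv by (simp add: f_def)
      moreover have "\<alpha> * r z (u, v) \<le> \<alpha> * \<xi>"
        using uv \<open>\<alpha> > 0\<close> by (simp add: r_def)
      ultimately show ?thesis by simp
    qed
    \<comment> \<open>The bound passes to the infimum, both sets being nonempty: they contain
      \<open>a'\<close> and \<open>b'\<close>.\<close>
    then have "dist a' b' - \<alpha> * \<xi> \<le> setdist (A \<inter> ball a' \<xi>) (B \<inter> ball b' \<xi>)"
      using ab' that by (intro le_setdistI) auto
    moreover have "\<alpha> * \<xi> < \<xi> * \<epsilon> / lam"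
      using \<delta>(1) \<open>lam > 0\<close> that by (simp add: \<alpha>_def field_simps)
    ultimately show ?thesis by simp
  qed
  show "\<exists>a' \<in> A \<inter> ball a lam. \<exists>b' \<in> B \<inter> ball b lam. dist a' b' \<le> dist a b \<and>
      (\<forall>\<xi>::real. \<xi> > 0 \<longrightarrow>
        setdist (A \<inter> ball a' \<xi>) (B \<inter> ball b' \<xi>) + \<xi> * \<epsilon> / lam > dist a' b')"
    using ab' ball i ii by blast
qed

end
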